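(* A dynamical system $(X,T)$ is mean equicontinuous if and only if it is mean-L-stable.
   Context: A dynamical system $(X,T)$ is a compact metric space $(X,d)$ together with a continuous map $T\colon X\to X$. $\mathbb{Z}_+$ denotes the non-negative integers. For $F\subset\mathbb{Z}_+$ the upper density is $\overline{D}(F)=\limsup_{n\to\infty}\frac{\#(F\cap[0,n-1])}{n}$. $(X,T)$ is mean equicontinuous if for every $\varepsilon>0$ there is $\delta>0$ such that for all $x,y\in X$ with $d(x,y)<\delta$, $\limsup_{n\to\infty}\frac1n\sum_{i=0}^{n-1}d(T^ix,T^iy)<\varepsilon$. $(X,T)$ is mean-L-stable if for every $\varepsilon>0$ there is $\delta>0$ such that $d(x,y)<\delta$ implies $d(T^nx,T^ny)<\varepsilon$ for all $n\in\mathbb{Z}_+$ except a set of upper density less than $\varepsilon$. *)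

theory Defs
  imports "HOL-Analysis.Analysis"
begin

text \<open>The phase space is a compact subset \<open>X\<close> of a metric-space type, with the metric
  inherited from \<open>dist\<close>; only the restriction of \<open>T\<close> to \<open>X\<close> matters.\<close>

definition dynamical_system :: "'a::metric_space set \<Rightarrow> ('a \<Rightarrow> 'a) \<Rightarrow> bool" where
  "dynamical_system X T \<longleftrightarrow> compact X \<and> continuous_on X T \<and> T \<in> X \<rightarrow> X"

text \<open>Upper limits are taken in the extended reals. The terms at \<open>n = 0\<close>, which are \<open>0\<close> because
  \<open>x / 0 = 0\<close>, do not influence them.\<close>

definition upper_density :: "nat set \<Rightarrow> ereal" where
  "upper_density F = limsup (\<lambda>n. ereal (real (card (F \<inter> {..<n})) / real n))"

definition mean_equicontinuous :: "'a::metric_space set \<Rightarrow> ('a \<Rightarrow> 'a) \<Rightarrow> bool" where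
  "mean_equicontinuous X T \<longleftrightarrow>
     (\<forall>\<epsilon>>0::real. \<exists>\<delta>>0. \<forall>x\<in>X. \<forall>y\<in>X. dist x y < \<delta> \<longrightarrow>
        limsup (\<lambda>n. ereal (1 / real n * (\<Sum>i<n. dist ((T ^^ i) x) ((T ^^ i) y)))) < ereal \<epsilon>)"

definition mean_L_stable :: "'a::metric_space set \<Rightarrow> ('a \<Rightarrow> 'a) \<Rightarrow> bool" where
  "mean_L_stable X T \<longleftrightarrow>
     (\<forall>\<epsilon>>0::real. \<exists>\<delta>>0. \<forall>x\<in>X. \<forall>y\<in>X. dist x y < \<delta> \<longrightarrow>
        (\<exists>E. upper_density E < ereal \<epsilon> \<and> (\<forall>n. n \<notin> E \<longrightarrow> dist ((T ^^ n) x) ((T ^^ n) y) < \<epsilon>)))"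

end

theory Submission
  imports Defs
begin

text \<open>Along a pair of orbits put a_i = d(T^i x, T^i y). The equivalence compares two ways for
  the sequence a to be small, convergence in mean and convergence in density, and for uniformly
  bounded sequences these control each other. The same \<delta> passes from one property to the
  other, once \<epsilon> is rescaled. If the averages of a are eventually below \<epsilon>^2,
  Markov's inequality shows that the times with a_i \<ge> \<epsilon> have upper density below
  \<epsilon> (\<open>upper_density_superlevel_less\<close>). Conversely, if a_i \<le> \<epsilon> off
  a set E of upper density below \<epsilon> and a is bounded by M, splitting the average over E and
  its complement bounds it by \<epsilon> + M\<epsilon> (\<open>limsup_average_less\<close>).
  Compactness of X supplies a bound M common to all pairs.\<close>

text \<open>The gap between s and e is what keeps the inequality strict: the estimates below are
  made for each large n and are only weak, so they are carried out with s in place of e.\<close>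

lemma limsup_ereal_less_iff:
  fixes f :: "nat \<Rightarrow> real"
  shows "limsup (\<lambda>n. ereal (f n)) < ereal e \<longleftrightarrow> (\<exists>s<e. \<forall>\<^sub>F n in sequentially. f n \<le> s)"
proof
  assume "limsup (\<lambda>n. ereal (f n)) < ereal e"
  then obtain s where s: "limsup (\<lambda>n. ereal (f n)) < ereal s" "ereal s < ereal e"
    using ereal_dense2 by blast
  have "\<forall>\<^sub>F n in sequentially. f n \<le> s"
    using Limsup_lessD[OF s(1)] by (rule eventually_mono) simp
  with s(2) show "\<exists>s<e. \<forall>\<^sub>F n in sequentially. f n \<le> s" by auto
next
  assume "\<exists>s<e. \<forall>\<^sub>F n in sequentially. f n \<le> s"
  then obtain s where s: "s < e" "\<forall>\<^sub>F n in sequentially. f n \<le> s" by blast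
  have "limsup (\<lambda>n. ereal (f n)) \<le> ereal s"
    by (rule Limsup_bounded) (use s(2) in simp)
  also have "\<dots> < ereal e" using s(1) by simp
  finally show "limsup (\<lambda>n. ereal (f n)) < ereal e" .
qed

text \<open>Markov's inequality for the counting average on [0, n): each index with a_i \<ge> c
  contributes at least c to a sum of non-negative terms.\<close>

lemma upper_density_superlevel_less:
  fixes a :: "nat \<Rightarrow> real"
  assumes "c > 0" and nonneg: "\<And>i. a i \<ge> 0"
    and "limsup (\<lambda>n. ereal (1 / real n * (\<Sum>i<n. a i))) < ereal (c * e)"
  shows "upper_density {i. a i \<ge> c} < ereal e"
proof -
  obtain s where s: "s < c * e"
    "\<forall>\<^sub>F n in sequentially. 1 / real n * (\<Sum>i<n. a i) \<le> s"
    using assms(3) limsup_ereal_less_iff[of "\<lambda>n. 1 / real n * (\<Sum>i<n. a i)"] by blast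
  have "real (card ({i. a i \<ge> c} \<inter> {..<n})) / real n \<le> s / c"
    if "1 / real n * (\<Sum>i<n. a i) \<le> s" for n
  proof -
    let ?A = "{i. a i \<ge> c} \<inter> {..<n}"
    have "real (card ?A) * c = (\<Sum>i\<in>?A. c)" by simp
    also have "\<dots> \<le> (\<Sum>i\<in>?A. a i)" by (rule sum_mono) auto
    also have "\<dots> \<le> (\<Sum>i<n. a i)" by (rule sum_mono2) (auto simp: nonneg)
    finally have "real (card ?A) * c / real n \<le> (\<Sum>i<n. a i) / real n"
      by (rule divide_right_mono) simp
    also have "\<dots> \<le> s" using that by simp
    finally show ?thesis using \<open>c > 0\<close> by (simp add: pos_le_divide_eq)
  qed
  then have "\<forall>\<^sub>F n in sequentially. real (card ({i. a i \<ge> c} \<inter> {..<n})) / real n \<le> s / c"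
    using s(2) by (rule eventually_mono[rotated])
  moreover have "s / c < e" using s(1) \<open>c > 0\<close> by (simp add: pos_divide_less_eq mult.commute)
  ultimately show ?thesis
    unfolding upper_density_def limsup_ereal_less_iff by blast
qed

text \<open>Indices outside E contribute at most e to the average; those in E contribute at most M
  each, and their proportion is eventually at most some s < e.\<close>

lemma limsup_average_less:
  fixes a :: "nat \<Rightarrow> real"
  assumes "upper_density E < ereal e" "e \<ge> 0" "M > 0"
    and bound: "\<And>i. a i \<le> M" and off: "\<And>i. i \<notin> E \<Longrightarrow> a i \<le> e"
  shows "limsup (\<lambda>n. ereal (1 / real n * (\<Sum>i<n. a i))) < ereal (e + M * e)"
proof -
  obtain s where s: "s < e"
    "\<forall>\<^sub>F n in sequentially. real (card (E \<inter> {..<n})) / real n \<le> s"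
    using assms(1) unfolding upper_density_def limsup_ereal_less_iff by blast
  have "1 / real n * (\<Sum>i<n. a i) \<le> e + M * s"
    if "real (card (E \<inter> {..<n})) / real n \<le> s" "n > 0" for n
  proof -
    \<comment> \<open>One majorant serves both cases: on E the bound M is enlarged by e \<ge> 0, off
      E the indicator vanishes.\<close>
    have "(\<Sum>i<n. a i) \<le> (\<Sum>i<n. e + M * indicator E i)"
    proof (rule sum_mono)
      show "a i \<le> e + M * indicator E i" for i
        using bound[of i] off[of i] \<open>e \<ge> 0\<close> by (cases "i \<in> E") auto
    qed
    also have "\<dots> = e * real n + M * real (card (E \<inter> {..<n}))"
      by (simp add: sum.distrib sum_distrib_left[symmetric] sum.If_cases indicator_def Int_commute)
    finally have "(\<Sum>i<n. a i) / real n \<le> e + M * (real (card (E \<inter> {..<n})) / real n)"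
      using \<open>n > 0\<close> by (simp add: field_simps)
    also have "\<dots> \<le> e + M * s"
      using mult_left_mono[OF that(1), of M] \<open>M > 0\<close> by simp
    finally show ?thesis by simp
  qed
  then have "\<forall>\<^sub>F n in sequentially. 1 / real n * (\<Sum>i<n. a i) \<le> e + M * s"
    by (intro eventually_elim2[OF s(2) eventually_gt_at_top[of 0]])
  moreover have "e + M * s < e + M * e" using s(1) \<open>M > 0\<close> by simp
  ultimately show ?thesis
    using limsup_ereal_less_iff[of "\<lambda>n. 1 / real n * (\<Sum>i<n. a i)"] by blast
qed

lemma mean_equicontinuous_imp_mean_L_stable:
  assumes "mean_equicontinuous X T"
  shows "mean_L_stable X T"
  unfolding mean_L_stable_def
proof (intro allI impI)
  fix e :: real assume "e > 0"
  \<comment> \<open>The average bound e * e is the threshold e times the desired density e, as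
    Markov's inequality requires.\<close>
  then obtain d where "d > 0" and d: "\<And>x y. x \<in> X \<Longrightarrow> y \<in> X \<Longrightarrow> dist x y < d \<Longrightarrow>
      limsup (\<lambda>n. ereal (1 / real n * (\<Sum>i<n. dist ((T ^^ i) x) ((T ^^ i) y)))) < ereal (e * e)"
    using assms unfolding mean_equicontinuous_def by (meson mult_pos_pos)
  have "\<exists>E. upper_density E < ereal e \<and> (\<forall>n. n \<notin> E \<longrightarrow> dist ((T ^^ n) x) ((T ^^ n) y) < e)"
    if "x \<in> X" "y \<in> X" "dist x y < d" for x y
    using upper_density_superlevel_less[OF \<open>e > 0\<close> zero_le_dist d[OF that]]
    \<comment> \<open>The exceptional set consists exactly of the times at which the orbits are at
      least e apart.\<close>
    by (intro exI[of _ "{i. e \<le> dist ((T ^^ i) x) ((T ^^ i) y)}"]) auto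
  with \<open>d > 0\<close> show "\<exists>d>0. \<forall>x\<in>X. \<forall>y\<in>X. dist x y < d \<longrightarrow>
      (\<exists>E. upper_density E < ereal e \<and> (\<forall>n. n \<notin> E \<longrightarrow> dist ((T ^^ n) x) ((T ^^ n) y) < e))"
    by blast
qed

lemma mean_L_stable_imp_mean_equicontinuous:
  assumes "bounded X" and T: "T \<in> X \<rightarrow> X" and "mean_L_stable X T"
  shows "mean_equicontinuous X T"
  unfolding mean_equicontinuous_def
proof (intro allI impI)
  fix e :: real assume "e > 0"
  obtain M where "M > 0" and M: "\<And>x y. x \<in> X \<Longrightarrow> y \<in> X \<Longrightarrow> dist x y \<le> M"
  proof
    \<comment> \<open>Adding 1 makes the bound positive even when the diameter is 0.\<close>
    show "diameter X + 1 > 0" using diameter_ge_0[OF \<open>bounded X\<close>] by simp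
    show "dist x y \<le> diameter X + 1" if "x \<in> X" "y \<in> X" for x y
      using diameter_bounded_bound[OF \<open>bounded X\<close> that] by simp
  qed
  have iter: "(T ^^ n) x \<in> X" if "x \<in> X" for n x
    using that T by (induction n) auto
  \<comment> \<open>Chosen so that the bound h + M * h given by \<open>limsup_average_less\<close>
    equals e.\<close>
  define h where "h = e / (1 + M)"
  have "h > 0"
    using \<open>e > 0\<close> \<open>M > 0\<close> by (simp add: h_def)
  have "h * (1 + M) = e"
    using \<open>M > 0\<close> by (simp add: h_def)
  then have h: "h + M * h = e"
    by (simp add: algebra_simps)
  from \<open>h > 0\<close> obtain d where "d > 0" and d: "\<And>x y. x \<in> X \<Longrightarrow> y \<in> X \<Longrightarrow> dist x y < d \<Longrightarrow>
      \<exists>E. upper_density E < ereal h \<and> (\<forall>n. n \<notin> E \<longrightarrow> dist ((T ^^ n) x) ((T ^^ n) y) < h)"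
    using assms(3) unfolding mean_L_stable_def by meson
  have "limsup (\<lambda>n. ereal (1 / real n * (\<Sum>i<n. dist ((T ^^ i) x) ((T ^^ i) y)))) < ereal e"
    if xy: "x \<in> X" "y \<in> X" "dist x y < d" for x y
  proof -
    obtain E where E: "upper_density E < ereal h"
      "\<And>n. n \<notin> E \<Longrightarrow> dist ((T ^^ n) x) ((T ^^ n) y) < h"
      using d[OF xy] by blast
    have "limsup (\<lambda>n. ereal (1 / real n * (\<Sum>i<n. dist ((T ^^ i) x) ((T ^^ i) y))))
        < ereal (h + M * h)"
      \<comment> \<open>Orbits stay in X, so M bounds their distance at every time, including the
        times in E.\<close>
      using \<open>h > 0\<close> \<open>M > 0\<close> M[OF iter iter, OF xy(1,2)] less_imp_le[OF E(2)]
      by (intro limsup_average_less[OF E(1)]) simp_all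
    then show ?thesis by (simp only: h)
  qed
  with \<open>d > 0\<close> show "\<exists>d>0. \<forall>x\<in>X. \<forall>y\<in>X. dist x y < d \<longrightarrow>
      limsup (\<lambda>n. ereal (1 / real n * (\<Sum>i<n. dist ((T ^^ i) x) ((T ^^ i) y)))) < ereal e"
    by blast
qed

theorem lemma3p1:
  fixes X :: "'a::metric_space set" and T :: "'a \<Rightarrow> 'a"
  assumes "dynamical_system X T"
  shows "mean_equicontinuous X T \<longleftrightarrow> mean_L_stable X T"
proof
  show "mean_equicontinuous X T \<Longrightarrow> mean_L_stable X T"
    by (rule mean_equicontinuous_imp_mean_L_stable)
  show "mean_L_stable X T \<Longrightarrow> mean_equicontinuous X T"
    using assms unfolding dynamical_system_def
    by (intro mean_L_stable_imp_mean_equicontinuous compact_imp_bounded) simp_all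
qed

end
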